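(* For every compact and convex (nonempty) subset $K\subset B_X$ of a Banach space $X$, there is an equivalent norm on $X$ such that the nearest point map (with respect to the new norm) from $B_X$ onto $K$ is well defined and uniformly continuous.
   Context: All Banach spaces are real; $B_X$ is the closed unit ball of $X$ (for the original norm). For a norm $|\cdot|$ on $X$, the nearest point map from $B_X$ onto $K$ assigns to $x\in B_X$ the point $R(x)\in K$ with $|R(x)-x|=\inf_{y\in K}|y-x|$; it is well defined if this point exists and is unique for every $x\in B_X$. *)

theory Defs
  imports "HOL-Analysis.Analysis"
begin

definition is_norm :: "('a::real_vector \<Rightarrow> real) \<Rightarrow> bool" where
  "is_norm N \<longleftrightarrow>
     (\<forall>x. 0 \<le> N x) \<and>
     (\<forall>x. N x = 0 \<longleftrightarrow> x = 0) \<and>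
     (\<forall>c x. N (c *\<^sub>R x) = \<bar>c\<bar> * N x) \<and>
     (\<forall>x y. N (x + y) \<le> N x + N y)"

definition equivalent_norm :: "('a::real_normed_vector \<Rightarrow> real) \<Rightarrow> bool" where
  "equivalent_norm N \<longleftrightarrow>
     is_norm N \<and> (\<exists>c>0. \<exists>C>0. \<forall>x. c * norm x \<le> N x \<and> N x \<le> C * norm x)"

definition is_nearest_point :: "('a::real_vector \<Rightarrow> real) \<Rightarrow> 'a set \<Rightarrow> 'a \<Rightarrow> 'a \<Rightarrow> bool" where
  "is_nearest_point N K x p \<longleftrightarrow> p \<in> K \<and> N (p - x) = (INF y\<in>K. N (y - x))"

definition nearest_point_well_defined_on ::
    "'a set \<Rightarrow> ('a::real_vector \<Rightarrow> real) \<Rightarrow> 'a set \<Rightarrow> bool" where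
  "nearest_point_well_defined_on B N K \<longleftrightarrow> (\<forall>x\<in>B. \<exists>!p. is_nearest_point N K x p)"

definition nearest_point_map :: "('a::real_vector \<Rightarrow> real) \<Rightarrow> 'a set \<Rightarrow> 'a \<Rightarrow> 'a" where
  "nearest_point_map N K x = (THE p. is_nearest_point N K x p)"

end

theory Submission
  imports Defs
begin

text \<open>By the Hahn--Banach theorem there are functionals \<open>f\<^sub>n\<close> of norm at most one that separate the
  points of the separable set \<open>K - K\<close>. The equivalent norm
  \<open>N x = sqrt (\<parallel>x\<parallel>\<^sup>2 + S x)\<close>, \<open>S x = (\<Sum>n. 2\<^sup>-\<^sup>n f\<^sub>n(x)\<^sup>2)\<close>, satisfies
  \<open>N ((a + b) / 2)\<^sup>2 \<le> (N a\<^sup>2 + N b\<^sup>2) / 2 - S (a - b) / 4\<close> because \<open>S\<close> obeys the parallelogram law.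
  Applied to the nearest points \<open>p\<close>, \<open>q\<close> of \<open>x\<close>, \<open>y\<close>, this bounds \<open>S (p - q)\<close> by a multiple of
  \<open>\<parallel>x - y\<parallel>\<close>; and on the compact set \<open>K - K\<close> a small value of \<open>S\<close> forces a small norm.

  Hahn--Banach itself is obtained from Zorn's lemma without partial extensions: a minimal sublinear
  functional is linear.\<close>

section \<open>Norming functionals\<close>

definition sublinear :: "('a::real_vector \<Rightarrow> real) \<Rightarrow> bool" where
  "sublinear q \<longleftrightarrow> (\<forall>x y. q (x + y) \<le> q x + q y) \<and> (\<forall>c\<ge>0. \<forall>x. q (c *\<^sub>R x) = c * q x)"

lemma sublinear_add: "sublinear q \<Longrightarrow> q (x + y) \<le> q x + q y"
  by (simp add: sublinear_def)

lemma sublinear_scaleR: "sublinear q \<Longrightarrow> 0 \<le> c \<Longrightarrow> q (c *\<^sub>R x) = c * q x"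
  by (simp add: sublinear_def)

lemma sublinear_zero: "sublinear q \<Longrightarrow> q 0 = 0"
  using sublinear_scaleR[of q 0 0] by simp

lemma sublinear_minus_le: "sublinear q \<Longrightarrow> - q (- x) \<le> q x"
  using sublinear_add[of q x "- x"] sublinear_zero[of q] by simp

text \<open>The one-sided scaling bound suffices: applied with \<open>1 / c\<close> to
  \<open>c *\<^sub>R x\<close> it gives the reverse inequality, and \<open>q 0 = 0\<close> follows
  from \<open>q 0 \<le> 2 * q 0\<close> and \<open>q 0 \<le> q 0 / 2\<close>.\<close>

lemma sublinearI:
  assumes add: "\<And>x y. q (x + y) \<le> q x + q y"
    and scale: "\<And>c x. 0 < c \<Longrightarrow> q (c *\<^sub>R x) \<le> c * q x"
  shows "sublinear q"
proof -
  have q0: "q 0 = 0"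
    using add[of 0 0] scale[of "1/2" 0] by simp
  have "q (c *\<^sub>R x) = c * q x" if "0 \<le> c" for c x
  proof (cases "c = 0")
    case False
    with that have c: "0 < c" by simp
    have "q x \<le> (1 / c) * q (c *\<^sub>R x)"
      using scale[of "1 / c" "c *\<^sub>R x"] c by simp
    then have "c * q x \<le> q (c *\<^sub>R x)"
      using c by (simp add: field_simps)
    with scale[OF c, of x] show ?thesis by simp
  qed (simp add: q0)
  with add show ?thesis by (simp add: sublinear_def)
qed

lemma le_INF_add_INF:
  fixes f g :: "_ \<Rightarrow> real"
  assumes "A \<noteq> {}" "B \<noteq> {}"
    and le: "\<And>s t. s \<in> A \<Longrightarrow> t \<in> B \<Longrightarrow> a \<le> f s + g t"
  shows "a \<le> (INF s\<in>A. f s) + (INF t\<in>B. g t)"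
proof -
  have "a - f s \<le> (INF t\<in>B. g t)" if "s \<in> A" for s
    using le[OF that] by (intro cINF_greatest assms) (simp add: algebra_simps)
  then have "a - (INF t\<in>B. g t) \<le> (INF s\<in>A. f s)"
    by (intro cINF_greatest assms) (simp add: algebra_simps)
  then show ?thesis by simp
qed

text \<open>The witness is the infimum over \<open>t \<ge> 0\<close> of
  \<open>q (x + t *\<^sub>R y) - t * q y\<close>: the value at \<open>t = 0\<close> gives
  \<open>r \<le> q\<close>, the value at \<open>t = 1\<close> the last bound. In particular
  \<open>r (- y) \<le> - q y\<close>.\<close>

lemma sublinear_directional_modification:
  fixes q :: "'a::real_vector \<Rightarrow> real"
  assumes q: "sublinear q"
  obtains r where "sublinear r" "r \<le> q" "\<And>x. r x \<le> q (x + y) - q y"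
proof
  let ?f = "\<lambda>x t. q (x + t *\<^sub>R y) - t * q y"
  let ?r = "\<lambda>x. INF t\<in>{0..}. ?f x t"
  have bdd: "bdd_below (?f x ` {0..})" for x
  proof (rule bdd_belowI2)
    fix t :: real assume "t \<in> {0..}"
    \<comment> \<open>Subadditivity yields a lower bound independent of \<open>t\<close>, so the
      infimum is a genuine one.\<close>
    then have "t * q y = q ((x + t *\<^sub>R y) + (- x))"
      using sublinear_scaleR[OF q, of t y] by simp
    also have "\<dots> \<le> q (x + t *\<^sub>R y) + q (- x)"
      by (rule sublinear_add[OF q])
    finally show "- q (- x) \<le> ?f x t" by simp
  qed
  have le: "?r x \<le> ?f x t" if "0 \<le> t" for x t
    using that by (intro cINF_lower bdd) simp
  show "sublinear ?r"
  proof (rule sublinearI)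
    fix x z
    show "?r (x + z) \<le> ?r x + ?r z"
    proof (rule le_INF_add_INF)
      fix s t :: real assume "s \<in> {0..}" "t \<in> {0..}"
      \<comment> \<open>Parameters add when vectors add, so \<open>s + t\<close> is the matching
        competitor.\<close>
      then have "?r (x + z) \<le> ?f (x + z) (s + t)"
        by (intro le) simp
      also have "\<dots> \<le> ?f x s + ?f z t"
        using sublinear_add[OF q, of "x + s *\<^sub>R y" "z + t *\<^sub>R y"]
        by (simp add: algebra_simps)
      finally show "?r (x + z) \<le> ?f x s + ?f z t" .
    qed auto
  next
    fix c :: real and x assume c: "0 < c"
    have "?r (c *\<^sub>R x) / c \<le> ?r x"
    proof (rule cINF_greatest)
      fix t :: real assume "t \<in> {0..}"
      then have "?r (c *\<^sub>R x) \<le> ?f (c *\<^sub>R x) (c * t)"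
        using c by (intro le) simp
      also have "\<dots> = c * ?f x t"
        using sublinear_scaleR[OF q, of c "x + t *\<^sub>R y"] c by (simp add: algebra_simps)
      finally show "?r (c *\<^sub>R x) / c \<le> ?f x t"
        using c by (simp add: field_simps)
    qed simp
    then show "?r (c *\<^sub>R x) \<le> c * ?r x"
      using c by (simp add: field_simps)
  qed
  show "?r \<le> q"
    using le[of 0] by (simp add: le_fun_def)
  show "?r x \<le> q (x + y) - q y" for x
    using le[of 1] by simp
qed

text \<open>Minimality makes the directional modification equal to \<open>q\<close>, whence
  \<open>q x \<le> q (x + y) - q y\<close>, the reverse of subadditivity.\<close>

lemma linear_if_minimal_sublinear:
  fixes q :: "'a::real_vector \<Rightarrow> real"
  assumes q: "sublinear q" and minimal: "\<And>r. sublinear r \<Longrightarrow> r \<le> q \<Longrightarrow> r = q"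
  shows "linear q"
proof (rule linearI)
  show add: "q (x + y) = q x + q y" for x y
  proof -
    obtain r where "sublinear r" "r \<le> q" "r x \<le> q (x + y) - q y"
      using sublinear_directional_modification[OF q, of y] by metis
    moreover from this have "r = q" by (intro minimal)
    ultimately show ?thesis using sublinear_add[OF q, of x y] by simp
  qed
  fix c x
  show "q (c *\<^sub>R x) = c *\<^sub>R q x"
  proof (cases "0 \<le> c")
    case False
    then have "q ((- c) *\<^sub>R x) = - c * q x"
      by (intro sublinear_scaleR q) simp
    moreover have "q (c *\<^sub>R x) + q ((- c) *\<^sub>R x) = 0"
      by (simp add: add[symmetric] sublinear_zero[OF q])
    ultimately show ?thesis by simp
  qed (simp add: sublinear_scaleR[OF q])
qed

lemma sublinear_INF_chain:
  fixes C :: "('a::real_vector \<Rightarrow> real) set"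
  assumes "C \<noteq> {}" and sub: "\<And>q. q \<in> C \<Longrightarrow> sublinear q"
    and total: "\<And>q r. q \<in> C \<Longrightarrow> r \<in> C \<Longrightarrow> q \<le> r \<or> r \<le> q"
    and bdd: "\<And>x. bdd_below ((\<lambda>q. q x) ` C)"
  shows "sublinear (\<lambda>x. INF q\<in>C. q x)" (is "sublinear ?u")
proof (rule sublinearI)
  have le: "?u x \<le> q x" if "q \<in> C" for q x
    using that by (intro cINF_lower bdd)
  fix x y
  show "?u (x + y) \<le> ?u x + ?u y"
  proof (rule le_INF_add_INF)
    fix q r assume qr: "q \<in> C" "r \<in> C"
    \<comment> \<open>In a chain the smaller of \<open>q\<close> and \<open>r\<close> serves both
      terms.\<close>
    then obtain m where m: "m \<in> C" "m \<le> q" "m \<le> r"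
      using total by blast
    have "?u (x + y) \<le> m x + m y"
      using le[OF m(1), of "x + y"] sublinear_add[OF sub[OF m(1)], of x y] by linarith
    also have "\<dots> \<le> q x + r y"
      using m by (intro add_mono) (auto simp: le_fun_def)
    finally show "?u (x + y) \<le> q x + r y" .
  qed (use assms in auto)
next
  have le: "?u x \<le> q x" if "q \<in> C" for q x
    using that by (intro cINF_lower bdd)
  fix c :: real and x assume c: "0 < c"
  have "?u (c *\<^sub>R x) / c \<le> ?u x"
  proof (rule cINF_greatest[OF \<open>C \<noteq> {}\<close>])
    fix q assume "q \<in> C"
    then show "?u (c *\<^sub>R x) / c \<le> q x"
      using le[of q "c *\<^sub>R x"] sublinear_scaleR[OF sub, of q c x] c
      by (simp add: field_simps)
  qed
  then show "?u (c *\<^sub>R x) \<le> c * ?u x"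
    using c by (simp add: field_simps)
qed

lemma linear_below_sublinear:
  fixes p :: "'a::real_vector \<Rightarrow> real"
  assumes p: "sublinear p"
  obtains f where "linear f" "f \<le> p"
proof -
  let ?A = "{q. sublinear q \<and> q \<le> p}"
  have "\<exists>m\<in>?A. \<forall>q\<in>?A. q \<le> m \<longrightarrow> q = m"
  \<comment> \<open>The order is reversed, so the maximal element supplied by Zorn's lemma is a
    minimal functional.\<close>
  proof (rule predicate_Zorn)
    show "partial_order_on ?A (relation_of (\<lambda>q r. r \<le> q) ?A)"
      by (rule partial_order_on_relation_ofI) auto
    fix C assume C: "C \<in> Chains (relation_of (\<lambda>q r. r \<le> q) ?A)"
    then have CA: "C \<subseteq> ?A" by (rule Chains_relation_of)
    show "\<exists>u\<in>?A. \<forall>q\<in>C. u \<le> q"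
    proof (cases "C = {}")
      case True
      with p show ?thesis by auto
    next
      case False
      let ?u = "\<lambda>x. INF q\<in>C. q x"
      have bdd: "bdd_below ((\<lambda>q. q x) ` C)" for x
      proof (rule bdd_belowI2)
        fix q assume "q \<in> C"
        with CA have "sublinear q" "q (- x) \<le> p (- x)" by (auto simp: le_fun_def)
        then show "- p (- x) \<le> q x"
          using sublinear_minus_le[of q x] by linarith
      qed
      have le: "?u \<le> q" if "q \<in> C" for q
        using that by (intro le_funI cINF_lower bdd)
      have "sublinear ?u"
      proof (rule sublinear_INF_chain[OF False _ _ bdd])
        show "sublinear q" if "q \<in> C" for q
          using that CA by blast
        show "q \<le> r \<or> r \<le> q" if "q \<in> C" "r \<in> C" for q r
          using that C unfolding Chains_def relation_of_def by blast
      qed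
      moreover have "?u \<le> p"
      proof -
        obtain q where "q \<in> C" using False by blast
        with CA have "q \<le> p" by blast
        with le[OF \<open>q \<in> C\<close>] show ?thesis by (rule order_trans)
      qed
      ultimately have "?u \<in> ?A" by simp
      with le show ?thesis by (intro bexI[of _ ?u]) simp_all
    qed
  qed
  then obtain m where m: "sublinear m" "m \<le> p" "\<And>q. sublinear q \<Longrightarrow> q \<le> p \<Longrightarrow> q \<le> m \<Longrightarrow> q = m"
    by blast
  then have "linear m"
    by (intro linear_if_minimal_sublinear) (auto intro: order_trans)
  with m that show thesis by blast
qed

text \<open>Modifying the norm in direction \<open>v\<close> gives
  \<open>r (- v) \<le> - norm v\<close>. Any linear \<open>f \<le> r\<close> then has
  \<open>f v \<ge> norm v\<close>.\<close>

lemma norming_functional: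
  fixes v :: "'a::real_normed_vector"
  obtains f where "linear f" "\<And>x. \<bar>f x\<bar> \<le> norm x" "f v = norm v"
proof -
  have "sublinear (norm :: 'a \<Rightarrow> real)"
    by (rule sublinearI) (auto intro: norm_triangle_ineq)
  then obtain r where r: "sublinear r" "r \<le> norm" "r (- v) \<le> norm (- v + v) - norm v"
    using sublinear_directional_modification[of norm v] by metis
  then obtain f where f: "linear f" "f \<le> r"
    using linear_below_sublinear by blast
  have le: "f x \<le> norm x" for x
    using f r by (meson le_funD order_trans)
  have "\<bar>f x\<bar> \<le> norm x" for x
    using le[of x] le[of "- x"] by (simp add: linear_neg[OF f(1)])
  moreover have "f v = norm v"
    using le[of v] f(2)[THEN le_funD, of "- v"] r(3) by (simp add: linear_neg[OF f(1)])
  ultimately show thesis using f that by blast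
qed

section \<open>Countable separating families on compact sets\<close>

text \<open>\<open>D\<close> collects the centres of finite \<open>1/(n+1)\<close>-nets.\<close>

lemma compact_countable_dense:
  fixes S :: "'a::metric_space set"
  assumes "compact S"
  obtains D where "countable D" "\<And>x e. x \<in> S \<Longrightarrow> 0 < e \<Longrightarrow> \<exists>d\<in>D. dist d x < e"
proof -
  have "\<exists>k. finite k \<and> S \<subseteq> (\<Union>x\<in>k. ball x (inverse (real (Suc n))))" for n
    using assms unfolding compact_eq_totally_bounded by (metis inverse_positive_iff_positive of_nat_0_less_iff zero_less_Suc)
  then obtain k where k: "\<And>n. finite (k n)" "\<And>n. S \<subseteq> (\<Union>x\<in>k n. ball x (inverse (real (Suc n))))"
    by metis
  show thesis
  proof
    show "countable (\<Union>n. k n)"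
      using k(1) by (auto intro: countable_finite)
    fix x and e :: real assume x: "x \<in> S" and "0 < e"
    then obtain n where "inverse (real (Suc n)) < e"
      using reals_Archimedean by blast
    moreover obtain d where "d \<in> k n" "dist d x < inverse (real (Suc n))"
      using k(2)[of n] x unfolding subset_iff UN_iff mem_ball by blast
    ultimately show "\<exists>d\<in>(\<Union>n. k n). dist d x < e"
      by (meson UN_I UNIV_I less_trans)
  qed
qed

text \<open>A functional norming \<open>d\<close> cannot vanish at a nonzero \<open>v\<close> with
  \<open>dist d v < norm v / 2\<close>: it is at least
  \<open>norm d - norm (d - v) \<ge> norm v - 2 * norm (d - v) > 0\<close> there.\<close>

lemma separating_functionals_on_compact:
  fixes S :: "'a::real_normed_vector set"
  assumes "compact S"
  obtains f :: "nat \<Rightarrow> 'a \<Rightarrow> real"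
    where "\<And>n. linear (f n)" "\<And>n x. \<bar>f n x\<bar> \<le> norm x"
      "\<And>v. v \<in> S \<Longrightarrow> v \<noteq> 0 \<Longrightarrow> \<exists>n. f n v \<noteq> 0"
proof -
  obtain D where D: "countable D" "\<And>x e. x \<in> S \<Longrightarrow> 0 < e \<Longrightarrow> \<exists>d\<in>D. dist d x < e"
    using compact_countable_dense[OF assms] by metis
  have "\<exists>g. linear g \<and> (\<forall>x. \<bar>g x\<bar> \<le> norm x) \<and> g v = norm v" for v :: 'a
    using norming_functional[of v] by metis
  then obtain g :: "'a \<Rightarrow> 'a \<Rightarrow> real"
    where g: "\<And>v. linear (g v)" "\<And>v x. \<bar>g v x\<bar> \<le> norm x" "\<And>v. g v v = norm v"
    by metis
  show thesis
  \<comment> \<open>\<open>from_nat_into\<close> is total: for finite \<open>D\<close> it repeats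
    elements and for empty \<open>D\<close> it is arbitrary. This is harmless, as \<open>g\<close>
    is linear and bounded at every index.\<close>
  proof (rule that[of "\<lambda>n. g (from_nat_into D n)"])
    fix v assume v: "v \<in> S" "v \<noteq> 0"
    then obtain d where d: "d \<in> D" "dist d v < norm v / 2"
      using D(2)[of v "norm v / 2"] by auto
    have "norm d - g d v \<le> norm (d - v)"
      using g(2)[of d "d - v"] g(3)[of d] by (simp add: linear_diff[OF g(1)])
    moreover have "norm v \<le> norm d + norm (d - v)"
      by (metis norm_minus_commute norm_triangle_sub)
    ultimately have "g d v \<noteq> 0"
      using d(2) by (auto simp: dist_norm)
    then show "\<exists>n. g (from_nat_into D n) v \<noteq> 0"
      using from_nat_into_surj[OF D(1) d(1)] by metis
  qed (use g in auto)
qed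

section \<open>Nearest points for a norm with a parallelogram defect\<close>

lemma is_norm_diff_commute:
  assumes "is_norm N"
  shows "N (x - y) = N (y - x)"
proof -
  have "N ((- 1) *\<^sub>R (y - x)) = \<bar>- 1\<bar> * N (y - x)"
    using assms unfolding is_norm_def by blast
  then show ?thesis by simp
qed

lemma is_norm_triangle:
  assumes "is_norm N"
  shows "N (x - z) \<le> N (x - y) + N (y - z)"
proof -
  have "N ((x - y) + (y - z)) \<le> N (x - y) + N (y - z)"
    using assms unfolding is_norm_def by blast
  then show ?thesis by simp
qed

lemma is_norm_continuous_on:
  assumes N: "is_norm N" and bound: "\<And>x. N x \<le> C * norm x"
  shows "continuous_on S N"
proof (rule lipschitz_on_continuous_on)
  \<comment> \<open>The absolute value makes the Lipschitz constant nonnegative whatever the sign of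
    \<open>C\<close>.\<close>
  have C: "N (x - y) \<le> \<bar>C\<bar> * dist x y" for x y
    using bound[of "x - y"] by (smt (verit) dist_norm mult_right_mono norm_ge_zero)
  have "N x - N y \<le> N (x - y)" for x y
    using is_norm_triangle[OF N, of x 0 y] by simp
  then show "\<bar>C\<bar>-lipschitz_on S N"
    by (intro lipschitz_onI) (smt (verit) C dist_commute dist_real_def, simp)
qed

text \<open>Nonnegativity of \<open>N\<close> bounds the infimum below, so it can be traded for
  pointwise minimality.\<close>

lemma is_nearest_point_iff:
  assumes "is_norm N" "K \<noteq> {}"
  shows "is_nearest_point N K x p \<longleftrightarrow> p \<in> K \<and> (\<forall>y\<in>K. N (p - x) \<le> N (y - x))"
proof -
  have bdd: "bdd_below ((\<lambda>y. N (y - x)) ` K)"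
    using assms by (intro bdd_belowI2[of _ 0]) (simp add: is_norm_def)
  show ?thesis
    unfolding is_nearest_point_def using assms
    by (auto intro!: antisym cINF_greatest cINF_lower bdd)
qed

text \<open>The midpoint of the two nearest points competes with the first one, so the defect
  \<^term>\<open>S (p - q)\<close> can only be as large as the error made by using \<^term>\<open>q\<close> for \<^term>\<open>x\<close>.\<close>

lemma nearest_points_defect_le:
  assumes N: "is_norm N" and K: "convex K" "K \<noteq> {}"
    and upper: "\<And>x. N x \<le> 2 * norm x"
    and defect: "\<And>a b. (N ((1/2) *\<^sub>R (a + b)))\<^sup>2 \<le> ((N a)\<^sup>2 + (N b)\<^sup>2) / 2 - S (a - b) / 4"
    and ball: "K \<subseteq> cball 0 1" "x \<in> cball 0 1" "y \<in> cball 0 1"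
    and p: "is_nearest_point N K x p" and q: "is_nearest_point N K y q"
  shows "S (p - q) \<le> 128 * dist x y"
proof -
  define d where "d = N (p - x)"
  define \<delta> where "\<delta> = N (x - y)"
  have pq: "p \<in> K" "q \<in> K" and pmin: "\<And>z. z \<in> K \<Longrightarrow> d \<le> N (z - x)"
    and qmin: "N (q - y) \<le> N (p - y)"
    using p q unfolding is_nearest_point_iff[OF N K(2)] d_def by auto
  have nonneg: "0 \<le> d" "0 \<le> \<delta>"
    using N by (auto simp: d_def \<delta>_def is_norm_def)
  have "norm (p - x) \<le> 2" "norm (x - y) \<le> 2"
    using norm_triangle_ineq4[of p x] norm_triangle_ineq4[of x y] pq ball by (auto simp: subset_iff)
  then have small: "d \<le> 4" "\<delta> \<le> 4" and \<delta>: "\<delta> \<le> 2 * dist x y"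
    using upper[of "p - x"] upper[of "x - y"] by (auto simp: d_def \<delta>_def dist_norm)
  \<comment> \<open>Go from \<open>q\<close> to \<open>y\<close>, replace \<open>q\<close> by
    \<open>p\<close> using minimality at \<open>y\<close>, and return to \<open>x\<close>; each
    passage between \<open>x\<close> and \<open>y\<close> costs \<open>\<delta>\<close>.\<close>
  have qx: "N (q - x) \<le> d + 2 * \<delta>"
    using is_norm_triangle[OF N, of q x y] is_norm_triangle[OF N, of p y x] qmin
      is_norm_diff_commute[OF N, of x y]
    by (simp add: d_def \<delta>_def)
  have "(1/2) *\<^sub>R p + (1/2) *\<^sub>R q \<in> K"
    using K(1) pq by (intro convexD) auto
  moreover have "(1/2) *\<^sub>R ((p - x) + (q - x)) = ((1/2) *\<^sub>R p + (1/2) *\<^sub>R q) - x"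
    by (simp add: algebra_simps flip: scaleR_2)
  ultimately have "d \<le> N ((1/2) *\<^sub>R ((p - x) + (q - x)))"
    using pmin by metis
  then have "d\<^sup>2 \<le> (N ((1/2) *\<^sub>R ((p - x) + (q - x))))\<^sup>2"
    using nonneg by (intro power_mono)
  also have "\<dots> \<le> (d\<^sup>2 + (N (q - x))\<^sup>2) / 2 - S (p - q) / 4"
    using defect[of "p - x" "q - x"] by (simp add: d_def)
  also have "\<dots> \<le> (d\<^sup>2 + (d + 2 * \<delta>)\<^sup>2) / 2 - S (p - q) / 4"
    using qx N by (simp add: power_mono is_norm_def)
  finally have "S (p - q) \<le> 8 * ((d + \<delta>) * \<delta>)"
    by (simp add: power2_eq_square algebra_simps)
  \<comment> \<open>Here \<open>d + \<delta> \<le> 8\<close>; with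
    \<open>\<delta> \<le> 2 * dist x y\<close> the constant becomes
    \<open>8 * 8 * 2 = 128\<close>.\<close>
  also have "\<dots> \<le> 8 * (8 * \<delta>)"
    using nonneg small by (intro mult_left_mono mult_right_mono) auto
  finally show ?thesis using \<delta> by simp
qed

text \<open>Compactness gives existence. The defect bound gives uniqueness when both centres
  coincide, and uniform continuity when they are close.\<close>

lemma nearest_point_map_uniformly_continuous:
  fixes K :: "'a::real_normed_vector set"
  assumes N: "is_norm N" and K: "compact K" "convex K" "K \<noteq> {}" "K \<subseteq> cball 0 1"
    and upper: "\<And>x. N x \<le> 2 * norm x"
    and defect: "\<And>a b. (N ((1/2) *\<^sub>R (a + b)))\<^sup>2 \<le> ((N a)\<^sup>2 + (N b)\<^sup>2) / 2 - S (a - b) / 4"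
    and S: "continuous_on UNIV S"
      "\<And>p q. p \<in> K \<Longrightarrow> q \<in> K \<Longrightarrow> p \<noteq> q \<Longrightarrow> 0 < S (p - q)"
  shows "nearest_point_well_defined_on (cball 0 1) N K"
    and "uniformly_continuous_on (cball 0 1) (nearest_point_map N K)"
proof -
  note iff = is_nearest_point_iff[OF N K(3)]
  note defect_le = nearest_points_defect_le[where N = N and S = S, OF N K(2,3) upper defect K(4)]
  have "\<exists>p. is_nearest_point N K x p" for x
  proof -
    have "continuous_on K (\<lambda>y. N (y - x))"
      by (rule continuous_on_compose2[OF is_norm_continuous_on[OF N upper, of UNIV]])
        (auto intro!: continuous_intros)
    from continuous_attains_inf[OF K(1,3) this] show ?thesis
      unfolding iff by blast
  qed
  moreover have "p = q" if "x \<in> cball 0 1" "is_nearest_point N K x p" "is_nearest_point N K x q" for x p q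
  proof (rule ccontr)
    assume "p \<noteq> q"
    moreover have "p \<in> K" "q \<in> K" using that iff by blast+
    ultimately show False
      using S(2)[of p q] defect_le[OF that(1,1,2,3)] by simp
  qed
  ultimately show wd: "nearest_point_well_defined_on (cball 0 1) N K"
    unfolding nearest_point_well_defined_on_def by blast
  let ?R = "nearest_point_map N K"
  have R: "is_nearest_point N K x (?R x)" if "x \<in> cball 0 1" for x
    using wd that unfolding nearest_point_well_defined_on_def nearest_point_map_def
    by (metis theI')
  show "uniformly_continuous_on (cball 0 1) ?R"
    unfolding uniformly_continuous_on_def
  proof (intro allI impI)
    fix e :: real assume e: "0 < e"
    \<comment> \<open>Differences of norm at least \<open>e\<close> form a compact set avoiding 0,
      on which \<open>S\<close> has a positive minimum \<open>m\<close>; then \<open>m / 128\<close>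
      is the required distance.\<close>
    let ?V = "{p - q |p q. p \<in> K \<and> q \<in> K} \<inter> {v. e \<le> norm v}"
    have V: "compact ?V"
      by (intro compact_Int_closed compact_differences K closed_Collect_le continuous_intros)
    have "\<exists>m>0. \<forall>v\<in>?V. m \<le> S v"
    proof (cases "?V = {}")
      case False
      obtain v where v: "v \<in> ?V" "\<forall>w\<in>?V. S v \<le> S w"
        using continuous_attains_inf[OF V False continuous_on_subset[OF S(1)]] by blast
      have "0 < S v"
        using v(1) e S(2) by force
      with v show ?thesis by blast
    \<comment> \<open>If \<open>?V\<close> is empty, any positive \<open>m\<close> works.\<close>
    qed (auto intro: exI[of _ 1])
    then obtain m where m: "0 < m" "\<And>v. v \<in> ?V \<Longrightarrow> m \<le> S v"
      by blast
    show "\<exists>d>0. \<forall>x\<in>cball 0 1. \<forall>x'\<in>cball 0 1. dist x' x < d \<longrightarrow> dist (?R x') (?R x) < e"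
    proof (intro exI conjI ballI impI)
      show "0 < m / 128" using m by simp
      fix x x' :: 'a assume x: "x \<in> cball 0 1" "x' \<in> cball 0 1" "dist x' x < m / 128"
      then have "S (?R x' - ?R x) < m"
        using defect_le[OF x(2,1) R[OF x(2)] R[OF x(1)]] by simp
      moreover have "?R x' \<in> K" "?R x \<in> K"
        using R x iff by blast+
      ultimately have "\<not> e \<le> norm (?R x' - ?R x)"
        using m(2)[of "?R x' - ?R x"] by force
      then show "dist (?R x') (?R x) < e"
        by (simp add: dist_norm)
    qed
  qed
qed

section \<open>The renorming\<close>

text \<open>The two sides differ by \<open>(s * u - v)\<^sup>2 / s\<close>. The free weight
  \<open>s\<close> lets the triangle inequality for \<open>N\<close> be proved term by term.\<close>

lemma square_add_le_weighted:
  fixes u v s :: real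
  assumes "0 < s"
  shows "(u + v)\<^sup>2 \<le> (1 + s) * u\<^sup>2 + (1 + 1 / s) * v\<^sup>2"
proof -
  have "0 \<le> (s * u - v)\<^sup>2 / s" using assms by simp
  also have "\<dots> = (1 + s) * u\<^sup>2 + (1 + 1 / s) * v\<^sup>2 - (u + v)\<^sup>2"
    using assms by (simp add: power2_eq_square field_simps)
  finally show ?thesis by simp
qed

locale bounded_functional_sequence =
  fixes f :: "nat \<Rightarrow> 'a::real_normed_vector \<Rightarrow> real"
  assumes linear: "\<And>n. linear (f n)"
    and bounded: "\<And>n x. \<bar>f n x\<bar> \<le> norm x"
begin

text \<open>The squared \<open>l2\<close> norm of the sequence \<open>2^(-n/2) * f n x\<close>,
  hence a quadratic form.\<close>

definition S :: "'a \<Rightarrow> real" where "S x = (\<Sum>n. (1/2) ^ n * (f n x)\<^sup>2)"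

definition N :: "'a \<Rightarrow> real" where "N x = sqrt ((norm x)\<^sup>2 + S x)"

lemma term_le: "(1/2) ^ n * (f n x)\<^sup>2 \<le> (1/2) ^ n * (norm x)\<^sup>2"
  using power_mono[OF bounded[of n x], of 2] by (intro mult_left_mono) auto

lemma summable: "summable (\<lambda>n. (1/2) ^ n * (f n x)\<^sup>2)"
  by (rule summable_comparison_test'[of "\<lambda>n. (1/2) ^ n * (norm x)\<^sup>2" 0])
    (use term_le in \<open>auto intro!: summable_mult2 summable_geometric\<close>)

lemma S_nonneg: "0 \<le> S x"
  unfolding S_def by (intro suminf_nonneg summable) simp

lemma S_le: "S x \<le> 2 * (norm x)\<^sup>2"
proof -
  have "S x \<le> (\<Sum>n. (1/2) ^ n * (norm x)\<^sup>2)"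
    unfolding S_def by (intro suminf_le term_le summable summable_mult2 summable_geometric) simp
  also have "\<dots> = 2 * (norm x)\<^sup>2"
    by (subst suminf_mult2[symmetric]) (auto simp: suminf_geometric summable_geometric)
  finally show ?thesis .
qed

lemma S_pos: "f n x \<noteq> 0 \<Longrightarrow> 0 < S x"
  unfolding S_def by (intro suminf_pos2[where i = n] summable) auto

lemma S_scaleR: "S (c *\<^sub>R x) = c\<^sup>2 * S x"
  unfolding S_def
  by (subst suminf_mult[OF summable, symmetric])
    (simp add: linear_scale[OF linear] power_mult_distrib mult_ac)

lemma S_parallelogram: "S (x + y) + S (x - y) = 2 * S x + 2 * S y"
proof -
  have "S (x + y) + S (x - y)
      = (\<Sum>n. (1/2) ^ n * (f n (x + y))\<^sup>2 + (1/2) ^ n * (f n (x - y))\<^sup>2)"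
    unfolding S_def by (intro suminf_add summable)
  also have "\<dots> = (\<Sum>n. 2 * ((1/2) ^ n * (f n x)\<^sup>2) + 2 * ((1/2) ^ n * (f n y)\<^sup>2))"
    by (simp add: linear_add[OF linear] linear_diff[OF linear] power2_eq_square algebra_simps)
  also have "\<dots> = 2 * S x + 2 * S y"
    unfolding S_def
    by (simp only: suminf_add[symmetric] suminf_mult summable summable_mult)
  finally show ?thesis .
qed

lemma S_add_le:
  assumes "0 < s"
  shows "S (x + y) \<le> (1 + s) * S x + (1 + 1 / s) * S y"
proof -
  have "S (x + y) \<le> (\<Sum>n. (1 + s) * ((1/2) ^ n * (f n x)\<^sup>2) + (1 + 1 / s) * ((1/2) ^ n * (f n y)\<^sup>2))"
    unfolding S_def
  proof (intro suminf_le summable summable_add summable_mult)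
    fix n
    show "(1/2) ^ n * (f n (x + y))\<^sup>2
        \<le> (1 + s) * ((1/2) ^ n * (f n x)\<^sup>2) + (1 + 1 / s) * ((1/2) ^ n * (f n y)\<^sup>2)"
      using mult_left_mono[OF square_add_le_weighted[OF assms, of "f n x" "f n y"], of "(1/2) ^ n"]
      by (simp add: linear_add[OF linear] distrib_left mult.left_commute)
  qed
  also have "\<dots> = (1 + s) * S x + (1 + 1 / s) * S y"
    unfolding S_def
    by (simp only: suminf_add[symmetric] suminf_mult summable summable_mult)
  finally show ?thesis .
qed

lemma N_square: "(N x)\<^sup>2 = (norm x)\<^sup>2 + S x"
  unfolding N_def using S_nonneg by simp

lemma norm_le_N: "norm x \<le> N x"
  unfolding N_def using S_nonneg by (simp add: real_le_rsqrt)

text \<open>In fact \<open>N x\<close> is at most \<open>sqrt 3 * norm x\<close>; the constant is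
  rounded up.\<close>

lemma N_le: "N x \<le> 2 * norm x"
  unfolding N_def using S_le[of x]
  by (intro real_le_lsqrt) (auto simp: power_mult_distrib, smt (verit) zero_le_power2)

lemma N_triangle: "N (x + y) \<le> N x + N y"
proof (cases "x = 0 \<or> y = 0")
  case True
  have "0 \<le> N z" for z by (meson norm_ge_zero norm_le_N order_trans)
  with True show ?thesis by auto
next
  case False
  then have pos: "0 < N x" "0 < N y"
    by (meson less_le_trans norm_le_N zero_less_norm_iff)+
  \<comment> \<open>This weight turns the weighted sum of \<open>(N x)\<^sup>2\<close> and
    \<open>(N y)\<^sup>2\<close> into exactly \<open>(N x + N y)\<^sup>2\<close>. It serves the norm
    part and the \<open>S\<close> part at once.\<close>
  define s where "s = N y / N x"
  have s: "0 < s" using pos by (simp add: s_def)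
  have "(norm (x + y))\<^sup>2 \<le> (norm x + norm y)\<^sup>2"
    by (intro power_mono norm_triangle_ineq) simp
  also have "\<dots> \<le> (1 + s) * (norm x)\<^sup>2 + (1 + 1 / s) * (norm y)\<^sup>2"
    by (rule square_add_le_weighted[OF s])
  finally have "(N (x + y))\<^sup>2 \<le> (1 + s) * (N x)\<^sup>2 + (1 + 1 / s) * (N y)\<^sup>2"
    using S_add_le[OF s, of x y] by (simp add: N_square algebra_simps)
  also have "\<dots> = (N x + N y)\<^sup>2"
    using pos by (simp add: s_def power2_eq_square field_simps)
  finally show ?thesis
    using pos by (intro power2_le_imp_le[of "N (x + y)"]) auto
qed

lemma is_norm_N: "is_norm N"
  unfolding is_norm_def
proof (intro conjI allI)
  fix x y :: 'a and c :: real
  show "0 \<le> N x" by (meson norm_ge_zero norm_le_N order_trans)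
  show "N x = 0 \<longleftrightarrow> x = 0"
    using norm_le_N[of x] N_le[of x] by auto
  show "N (c *\<^sub>R x) = \<bar>c\<bar> * N x"
    by (simp add: N_def S_scaleR power_mult_distrib real_sqrt_mult flip: distrib_left)
  show "N (x + y) \<le> N x + N y" by (rule N_triangle)
qed

lemma equivalent_norm_N: "equivalent_norm N"
  unfolding equivalent_norm_def
proof (intro conjI exI allI)
  show "is_norm N" by (rule is_norm_N)
  show "1 * norm x \<le> N x" "N x \<le> 2 * norm x" for x
    using norm_le_N N_le by auto
qed simp_all

text \<open>The norm part contributes convexity of the square, the \<open>S\<close> part an exact
  parallelogram identity, which leaves the defect.\<close>

lemma N_midpoint: "(N ((1/2) *\<^sub>R (a + b)))\<^sup>2 \<le> ((N a)\<^sup>2 + (N b)\<^sup>2) / 2 - S (a - b) / 4"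
proof -
  have "(norm (a + b))\<^sup>2 \<le> (norm a + norm b)\<^sup>2"
    by (intro power_mono norm_triangle_ineq) simp
  also have "\<dots> \<le> 2 * (norm a)\<^sup>2 + 2 * (norm b)\<^sup>2"
    using square_add_le_weighted[of 1 "norm a" "norm b"] by simp
  finally have "(norm (a + b))\<^sup>2 \<le> 2 * (norm a)\<^sup>2 + 2 * (norm b)\<^sup>2" .
  moreover have "(N ((1/2) *\<^sub>R (a + b)))\<^sup>2 = ((norm (a + b))\<^sup>2 + S (a + b)) / 4"
    by (simp add: N_square S_scaleR power_divide add_divide_distrib del: scaleR_add_right)
  ultimately show ?thesis
    using S_parallelogram[of a b] by (simp add: N_square field_simps)
qed

text \<open>Reading \<open>S\<close> as a difference of squares of continuous norms avoids a uniform
  convergence argument for the series.\<close>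

lemma continuous_on_S: "continuous_on A S"
proof -
  have "S = (\<lambda>x. (N x)\<^sup>2 - (norm x)\<^sup>2)"
    by (simp add: N_square)
  moreover have "continuous_on A (\<lambda>x. (N x)\<^sup>2 - (norm x)\<^sup>2)"
    by (intro continuous_intros is_norm_continuous_on[OF is_norm_N N_le])
  ultimately show ?thesis by simp
qed

end

theorem corollary6p10:
  fixes K :: "'a::banach set"
  assumes "compact K" and "convex K" and "K \<noteq> {}" and "K \<subseteq> cball 0 1"
  shows "\<exists>N :: 'a \<Rightarrow> real. equivalent_norm N \<and>
           nearest_point_well_defined_on (cball 0 1) N K \<and>
           uniformly_continuous_on (cball 0 1) (nearest_point_map N K)"
proof -
  obtain f :: "nat \<Rightarrow> 'a \<Rightarrow> real"
    where f: "\<And>n. linear (f n)" "\<And>n x. \<bar>f n x\<bar> \<le> norm x"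
      and sep: "\<And>v. v \<in> {p - q |p q. p \<in> K \<and> q \<in> K} \<Longrightarrow> v \<noteq> 0 \<Longrightarrow> \<exists>n. f n v \<noteq> 0"
    by (rule separating_functionals_on_compact[OF compact_differences[OF assms(1,1)]]) blast
  interpret bounded_functional_sequence f
    using f by (rule bounded_functional_sequence.intro)
  have "0 < S (p - q)" if "p \<in> K" "q \<in> K" "p \<noteq> q" for p q
    using sep[of "p - q"] S_pos that by auto
  note nearest = nearest_point_map_uniformly_continuous
    [where N = N and S = S, OF is_norm_N assms N_le N_midpoint continuous_on_S this]
  show ?thesis
    using equivalent_norm_N nearest by (intro exI[of _ N] conjI)
qed

end
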